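(* Let $X$ be the Banach space of all $x=(x_n)\in\mathbb K^{\mathbb N}$ with $$\|x\|_X=\sup_{\substack{F\subseteq\mathbb N\text{ finite}\\ F\neq\varnothing}}\frac1{\sqrt{|F|}}\sum_{n\in F}|x_n|<\infty ,$$ and let $\delta_n\in X^*$, $\delta_n(x)=x_n$, be the coordinate functionals. Then $(\delta_n)_{n\in\mathbb N}$ is a sequence in $X^*$ with $\|\delta_n\|=1$ for all $n$, it converges weakly to zero in $X^*$ (that is, in $\sigma(X^*,X^{**})$), and it has no strongly normal subsequence. Moreover, $X$ is not isomorphic (as a Banach space, i.e. linearly homeomorphic) to $\ell_1(\Gamma)$ for any set $\Gamma$.
   Context: Banach spaces are over $\mathbb K\in\{\mathbb R,\mathbb C\}$. For a Banach space $E$, a sequence $(y_n^* )$ in the unit sphere of $E^*$ is called strongly normal if the linear subspace $\{x\in E:\sum_{n=1}^\infty |y_n^*(x)|<\infty\}$ is norm dense in $E$. $\ell_1(\Gamma)$ is the Banach space of absolutely summable families of scalars indexed by $\Gamma$, with norm $\|x\|=\sum_{\gamma\in\Gamma}|x(\gamma)|$. *)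

theory Defs
  imports "HOL-Analysis.Analysis"
begin

section \<open>Banach spaces over a scalar field\<close>

text \<open>
  The scalar field is a type \<open>'k\<close> of sort \<open>{real_normed_field, banach}\<close>. The types
  \<^typ>\<open>real\<close> and \<^typ>\<open>complex\<close> have this sort; by the Gelfand--Mazur theorem every other
  type of this sort is isometrically isomorphic, as a normed field over the reals, to one of them.

  A Banach space over \<open>'k\<close> is a type of class \<^class>\<open>banach\<close> with a scalar multiplication by \<open>'k\<close>
  extending the one by real numbers.
\<close>

locale banach_over = vector_space smul
  for smul :: "'k::{real_normed_field,banach} \<Rightarrow> 'a::banach \<Rightarrow> 'a" +
  assumes scale_of_real: "smul (of_real r) x = r *\<^sub>R x"
    and norm_scale: "norm (smul c x) = norm c * norm x"

text \<open>
  \<^typ>\<open>'a \<Rightarrow>\<^sub>L 'k\<close> consists of the bounded \<^emph>\<open>real\<close>-linear maps, so homogeneity over \<open>'k\<close> is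
  imposed in addition. The norm of the dual is the operator norm of \<^typ>\<open>'a \<Rightarrow>\<^sub>L 'k\<close>.
\<close>

definition dual_space ::
    "('k::{real_normed_field,banach} \<Rightarrow> 'a::banach \<Rightarrow> 'a) \<Rightarrow> ('a \<Rightarrow>\<^sub>L 'k) set" where
  "dual_space smul = {f :: 'a \<Rightarrow>\<^sub>L 'k. \<forall>c x. f (smul c x) = c * f x}"

definition scale_dual ::
    "'k::{real_normed_field,banach} \<Rightarrow> ('a::banach \<Rightarrow>\<^sub>L 'k) \<Rightarrow> ('a \<Rightarrow>\<^sub>L 'k)" where
  "scale_dual c f = blinfun_mult_right c o\<^sub>L f"

lemma scale_dual_apply: "scale_dual c f x = c * f x"
  by (simp add: scale_dual_def)

text \<open>The values of an element of the bidual outside the dual space are irrelevant.\<close>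

definition bidual_space ::
    "('k::{real_normed_field,banach} \<Rightarrow> 'a::banach \<Rightarrow> 'a) \<Rightarrow> (('a \<Rightarrow>\<^sub>L 'k) \<Rightarrow> 'k) set" where
  "bidual_space smul = {\<phi>.
     (\<forall>f\<in>dual_space smul. \<forall>g\<in>dual_space smul. \<phi> (f + g) = \<phi> f + \<phi> g) \<and>
     (\<forall>c. \<forall>f\<in>dual_space smul. \<phi> (scale_dual c f) = c * \<phi> f) \<and>
     (\<exists>B. \<forall>f\<in>dual_space smul. norm (\<phi> f) \<le> B * norm f)}"

text \<open>The initial topology \<open>\<sigma>(E\<^sup>*, E\<^sup>*\<^sup>*)\<close> on the dual space.\<close>

definition weak_topology_dual ::
    "('k::{real_normed_field,banach} \<Rightarrow> 'a::banach \<Rightarrow> 'a) \<Rightarrow> ('a \<Rightarrow>\<^sub>L 'k) topology" where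
  "weak_topology_dual smul =
     pullback_topology (dual_space smul) (\<lambda>f. \<lambda>\<phi>\<in>bidual_space smul. \<phi> f)
       (product_topology (\<lambda>_. euclidean) (bidual_space smul))"

definition strongly_normal ::
    "('k::{real_normed_field,banach} \<Rightarrow> 'a::banach \<Rightarrow> 'a) \<Rightarrow> (nat \<Rightarrow> ('a \<Rightarrow>\<^sub>L 'k)) \<Rightarrow> bool" where
  "strongly_normal smul y \<longleftrightarrow>
     (\<forall>n. y n \<in> dual_space smul \<and> norm (y n) = 1) \<and>
     closure {x. summable (\<lambda>n. norm (y n x))} = UNIV"


section \<open>A completeness lemma\<close>

lemma weighted_sums_complete:
  fixes u :: "nat \<Rightarrow> 'i \<Rightarrow> 'k::banach" and w :: "'i set \<Rightarrow> real"
  assumes w: "\<And>F. finite F \<Longrightarrow> F \<noteq> {} \<Longrightarrow> w F > 0"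
    and C: "\<And>e. e > 0 \<Longrightarrow> \<exists>M. \<forall>m\<ge>M. \<forall>n\<ge>M. \<forall>F. finite F \<longrightarrow> F \<noteq> {} \<longrightarrow>
              w F * (\<Sum>i\<in>F. norm (u m i - u n i)) \<le> e"
  obtains v where "\<And>e. e > 0 \<Longrightarrow> \<exists>M. \<forall>n\<ge>M. \<forall>F. finite F \<longrightarrow> F \<noteq> {} \<longrightarrow>
              w F * (\<Sum>i\<in>F. norm (u n i - v i)) \<le> e"
proof -
  have "convergent (\<lambda>n. u n i)" for i
  proof (rule Cauchy_convergent, rule metric_CauchyI)
    fix e :: real assume e: "e > 0"
    have wi: "w {i} > 0" using w by simp
    obtain M where M: "\<forall>m\<ge>M. \<forall>n\<ge>M. \<forall>F. finite F \<longrightarrow> F \<noteq> {} \<longrightarrow>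
              w F * (\<Sum>i\<in>F. norm (u m i - u n i)) \<le> e / 2 * w {i}"
      using C[of "e / 2 * w {i}"] e wi by auto
    have "dist (u m i) (u n i) < e" if "m \<ge> M" "n \<ge> M" for m n
    proof -
      have "w {i} * norm (u m i - u n i) \<le> e / 2 * w {i}"
        using M[rule_format, OF that, of "{i}"] by simp
      then have "norm (u m i - u n i) \<le> e / 2" using wi by (simp add: mult.commute)
      then show ?thesis using e by (simp add: dist_norm)
    qed
    then show "\<exists>M. \<forall>m\<ge>M. \<forall>n\<ge>M. dist (u m i) (u n i) < e" by blast
  qed
  then obtain v where v: "\<And>i. (\<lambda>n. u n i) \<longlonglongrightarrow> v i"
    unfolding convergent_def by metis
  show thesis
  proof
    fix e :: real assume "e > 0"
    then obtain M where M: "\<forall>m\<ge>M. \<forall>n\<ge>M. \<forall>F. finite F \<longrightarrow> F \<noteq> {} \<longrightarrow>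
              w F * (\<Sum>i\<in>F. norm (u m i - u n i)) \<le> e"
      using C by blast
    have "w F * (\<Sum>i\<in>F. norm (u n i - v i)) \<le> e" if "n \<ge> M" "finite F" "F \<noteq> {}" for n F
    proof (rule LIMSEQ_le_const2)
      show "(\<lambda>m. w F * (\<Sum>i\<in>F. norm (u n i - u m i))) \<longlonglongrightarrow> w F * (\<Sum>i\<in>F. norm (u n i - v i))"
        by (intro tendsto_intros v)
      show "\<exists>N. \<forall>m\<ge>N. w F * (\<Sum>i\<in>F. norm (u n i - u m i)) \<le> e"
        using M that by blast
    qed
    then show "\<exists>M. \<forall>n\<ge>M. \<forall>F. finite F \<longrightarrow> F \<noteq> {} \<longrightarrow>
              w F * (\<Sum>i\<in>F. norm (u n i - v i)) \<le> e" by blast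
  qed
qed


section \<open>The space \<open>X\<close>\<close>

definition mean_sqrt :: "nat set \<Rightarrow> (nat \<Rightarrow> 'k::real_normed_field) \<Rightarrow> real" where
  "mean_sqrt F x = 1 / sqrt (real (card F)) * (\<Sum>n\<in>F. norm (x n))"

typedef (overloaded) 'k X_space =
  "{x :: nat \<Rightarrow> 'k::real_normed_field. bdd_above ((\<lambda>F. mean_sqrt F x) ` {F. finite F \<and> F \<noteq> {}})}"
  morphisms X_coord Abs_X
proof
  show "(\<lambda>_. 0) \<in> {x :: nat \<Rightarrow> 'k. bdd_above ((\<lambda>F. mean_sqrt F x) ` {F. finite F \<and> F \<noteq> {}})}"
    by (auto simp: mean_sqrt_def intro!: bdd_aboveI[of _ 0])
qed

setup_lifting type_definition_X_space

lemma mean_sqrt_add: "mean_sqrt F (\<lambda>n. x n + y n) \<le> mean_sqrt F x + mean_sqrt F y"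
proof -
  have "(\<Sum>n\<in>F. norm (x n + y n)) \<le> (\<Sum>n\<in>F. norm (x n)) + (\<Sum>n\<in>F. norm (y n))"
    by (simp add: sum.distrib[symmetric] sum_mono norm_triangle_ineq)
  then show ?thesis
    unfolding mean_sqrt_def by (simp add: distrib_left[symmetric] divide_right_mono add_divide_distrib[symmetric])
qed

lemma mean_sqrt_mult: "mean_sqrt F (\<lambda>n. c * x n) = norm c * mean_sqrt F x"
  by (simp add: mean_sqrt_def norm_mult sum_distrib_left[symmetric])

lemma mean_sqrt_uminus: "mean_sqrt F (\<lambda>n. - x n) = mean_sqrt F x"
  by (simp add: mean_sqrt_def)

lemma mean_sqrt_zero: "mean_sqrt F (\<lambda>n. 0) = 0"
  by (simp add: mean_sqrt_def)

lemma bdd_mean_sqrt_add: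
  assumes "bdd_above ((\<lambda>F. mean_sqrt F x) ` {F. finite F \<and> F \<noteq> {}})"
    and "bdd_above ((\<lambda>F. mean_sqrt F y) ` {F. finite F \<and> F \<noteq> {}})"
  shows "bdd_above ((\<lambda>F. mean_sqrt F (\<lambda>n. x n + y n)) ` {F. finite F \<and> F \<noteq> {}})"
proof -
  from assms(1) have "\<exists>A. \<forall>F. finite F \<and> F \<noteq> {} \<longrightarrow> mean_sqrt F x \<le> A"
    unfolding bdd_above_def by blast
  then obtain A where A: "\<And>F. finite F \<and> F \<noteq> {} \<Longrightarrow> mean_sqrt F x \<le> A"
    by metis
  from assms(2) have "\<exists>B. \<forall>F. finite F \<and> F \<noteq> {} \<longrightarrow> mean_sqrt F y \<le> B"
    unfolding bdd_above_def by blast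
  then obtain B where B: "\<And>F. finite F \<and> F \<noteq> {} \<Longrightarrow> mean_sqrt F y \<le> B"
    by metis
  show ?thesis
  proof (rule bdd_aboveI2)
    fix F :: "nat set" assume F: "F \<in> {F. finite F \<and> F \<noteq> {}}"
    have "mean_sqrt F x \<le> A" "mean_sqrt F y \<le> B" using F by (auto intro: A B)
    with mean_sqrt_add[of F x y] show "mean_sqrt F (\<lambda>n. x n + y n) \<le> A + B" by linarith
  qed
qed

lemma bdd_mean_sqrt_mult:
  assumes "bdd_above ((\<lambda>F. mean_sqrt F x) ` {F. finite F \<and> F \<noteq> {}})"
  shows "bdd_above ((\<lambda>F. mean_sqrt F (\<lambda>n. c * x n)) ` {F. finite F \<and> F \<noteq> {}})"
proof -
  from assms(1) have "\<exists>A. \<forall>F. finite F \<and> F \<noteq> {} \<longrightarrow> mean_sqrt F x \<le> A"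
    unfolding bdd_above_def by blast
  then obtain A where A: "\<And>F. finite F \<and> F \<noteq> {} \<Longrightarrow> mean_sqrt F x \<le> A"
    by metis
  show ?thesis
  proof (rule bdd_aboveI2)
    fix F :: "nat set" assume "F \<in> {F. finite F \<and> F \<noteq> {}}"
    then have "mean_sqrt F x \<le> A" by (intro A) simp
    then show "mean_sqrt F (\<lambda>n. c * x n) \<le> norm c * A"
      unfolding mean_sqrt_mult by (rule mult_left_mono) simp
  qed
qed

lift_definition scale_X :: "'k::real_normed_field \<Rightarrow> 'k X_space \<Rightarrow> 'k X_space" is "\<lambda>c x n. c * x n"
  by (rule bdd_mean_sqrt_mult)

instantiation X_space :: (real_normed_field) real_normed_vector
begin

lift_definition zero_X_space :: "'a X_space" is "\<lambda>_. 0"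
  by (auto simp: mean_sqrt_zero intro!: bdd_aboveI[of _ 0])

lift_definition plus_X_space :: "'a X_space \<Rightarrow> 'a X_space \<Rightarrow> 'a X_space" is "\<lambda>x y n. x n + y n"
  by (rule bdd_mean_sqrt_add)

lift_definition uminus_X_space :: "'a X_space \<Rightarrow> 'a X_space" is "\<lambda>x n. - x n"
  by (simp add: mean_sqrt_uminus)

lift_definition minus_X_space :: "'a X_space \<Rightarrow> 'a X_space \<Rightarrow> 'a X_space" is "\<lambda>x y n. x n - y n"
  using bdd_mean_sqrt_add[of _ "\<lambda>n. - _ n"] by (simp add: mean_sqrt_uminus)

lift_definition scaleR_X_space :: "real \<Rightarrow> 'a X_space \<Rightarrow> 'a X_space" is "\<lambda>r x n. r *\<^sub>R x n"
  by (simp add: scaleR_conv_of_real bdd_mean_sqrt_mult)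

lift_definition norm_X_space :: "'a X_space \<Rightarrow> real" is
  "\<lambda>x. SUP F\<in>{F. finite F \<and> F \<noteq> {}}. mean_sqrt F x" .

definition dist_X_space :: "'a X_space \<Rightarrow> 'a X_space \<Rightarrow> real"
  where "dist_X_space x y = norm (x - y)"

definition uniformity_X_space :: "('a X_space \<times> 'a X_space) filter"
  where "uniformity_X_space = (INF e\<in>{0 <..}. principal {(x, y). dist x y < e})"

definition open_X_space :: "'a X_space set \<Rightarrow> bool"
  where "open_X_space S = (\<forall>x\<in>S. \<forall>\<^sub>F (x', y) in uniformity. x' = x \<longrightarrow> y \<in> S)"

definition sgn_X_space :: "'a X_space \<Rightarrow> 'a X_space"
  where "sgn_X_space x = scaleR (inverse (norm x)) x"

lemma mean_sqrt_le_norm: "finite F \<Longrightarrow> F \<noteq> {} \<Longrightarrow> mean_sqrt F (X_coord x) \<le> norm x"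
  by transfer (auto intro: cSUP_upper)

lemma norm_X_leI: "(\<And>F. finite F \<Longrightarrow> F \<noteq> {} \<Longrightarrow> mean_sqrt F (X_coord x) \<le> B) \<Longrightarrow> norm x \<le> B"
  by transfer (rule cSUP_least, auto)

lemma norm_X_coord_le: "norm (X_coord x n) \<le> norm x"
  using mean_sqrt_le_norm[of "{n}" x] by (simp add: mean_sqrt_def)

instance
proof
  fix x y z :: "'a X_space" and r s :: real
  show "dist x y = norm (x - y)" by (rule dist_X_space_def)
  show "sgn x = inverse (norm x) *\<^sub>R x" by (rule sgn_X_space_def)
  show "uniformity = (INF e\<in>{0<..}. principal {(x::'a X_space, y). dist x y < e})"
    by (rule uniformity_X_space_def)
  show "open S = (\<forall>x\<in>S. \<forall>\<^sub>F (x', y) in uniformity. x' = x \<longrightarrow> y \<in> S)" for S :: "'a X_space set"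
    by (rule open_X_space_def)
  show "x + y + z = x + (y + z)" "x + y = y + x" "0 + x = x" "- x + x = 0" "x - y = x + - y"
    by (transfer; auto simp: algebra_simps)+
  show "r *\<^sub>R (x + y) = r *\<^sub>R x + r *\<^sub>R y" "(r + s) *\<^sub>R x = r *\<^sub>R x + s *\<^sub>R x"
    "r *\<^sub>R s *\<^sub>R x = (r * s) *\<^sub>R x" "1 *\<^sub>R x = x"
    by (transfer; auto simp: algebra_simps)+
  show "norm x = 0 \<longleftrightarrow> x = 0"
  proof
    assume "norm x = 0"
    then have "X_coord x n = 0" for n using norm_X_coord_le[of x n] by simp
    then show "x = 0" by transfer auto
  next
    assume "x = 0"
    then have *: "X_coord x = (\<lambda>_. 0)" by (simp add: zero_X_space.rep_eq)
    have "norm x \<le> 0" by (rule norm_X_leI) (simp add: * mean_sqrt_zero)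
    moreover have "norm x \<ge> 0" using order_trans[OF norm_ge_zero norm_X_coord_le] .
    ultimately show "norm x = 0" by simp
  qed
  show "norm (x + y) \<le> norm x + norm y"
  proof (rule norm_X_leI)
    fix F :: "nat set" assume F: "finite F" "F \<noteq> {}"
    show "mean_sqrt F (X_coord (x + y)) \<le> norm x + norm y"
      using mean_sqrt_add[of F "X_coord x" "X_coord y"] mean_sqrt_le_norm[OF F, of x]
        mean_sqrt_le_norm[OF F, of y]
      by (simp add: plus_X_space.rep_eq)
  qed
  have le: "norm (r *\<^sub>R x) \<le> \<bar>r\<bar> * norm x" for r and x :: "'a X_space"
    by (rule norm_X_leI)
      (auto simp: scaleR_X_space.rep_eq scaleR_conv_of_real mean_sqrt_mult
        intro!: mult_left_mono mean_sqrt_le_norm)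
  show "norm (r *\<^sub>R x) = \<bar>r\<bar> * norm x"
  proof (cases "r = 0")
    case True
    then show ?thesis using le[of 0 x] order_trans[OF norm_ge_zero norm_X_coord_le, of "0 *\<^sub>R x"]
      by simp
  next
    case False
    have "inverse r *\<^sub>R r *\<^sub>R x = x" using False by transfer simp
    then have "norm x \<le> \<bar>inverse r\<bar> * norm (r *\<^sub>R x)" using le[of "inverse r" "r *\<^sub>R x"] by simp
    then have "\<bar>r\<bar> * norm x \<le> norm (r *\<^sub>R x)" using False by (simp add: field_simps)
    then show ?thesis using le[of r x] by simp
  qed
qed

end

instance X_space :: ("{real_normed_field,banach}") banach
proof
  fix u :: "nat \<Rightarrow> 'a X_space"
  assume "Cauchy u"
  define w where "w F = 1 / sqrt (real (card F))" for F :: "nat set"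
  have w: "w F > 0" if "finite F" "F \<noteq> {}" for F
    using that by (simp add: w_def card_gt_0_iff)
  have wm: "w F * (\<Sum>i\<in>F. norm (x i)) = mean_sqrt F x" for F and x :: "nat \<Rightarrow> 'a"
    by (simp add: w_def mean_sqrt_def)
  have C: "\<exists>M. \<forall>m\<ge>M. \<forall>n\<ge>M. \<forall>F. finite F \<longrightarrow> F \<noteq> {} \<longrightarrow>
              w F * (\<Sum>i\<in>F. norm (X_coord (u m) i - X_coord (u n) i)) \<le> e" if "e > 0" for e
  proof -
    obtain M where "\<forall>m\<ge>M. \<forall>n\<ge>M. dist (u m) (u n) < e"
      using metric_CauchyD[OF \<open>Cauchy u\<close> \<open>e > 0\<close>] by blast
    then have M: "norm (u m - u n) \<le> e" if "m \<ge> M" "n \<ge> M" for m n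
      using that by (simp add: dist_norm less_imp_le)
    have "mean_sqrt F (\<lambda>i. X_coord (u m) i - X_coord (u n) i) \<le> e"
      if "m \<ge> M" "n \<ge> M" "finite F" "F \<noteq> {}" for m n F
      using order_trans[OF mean_sqrt_le_norm[OF that(3,4), of "u m - u n"] M[OF that(1,2)]]
      by (simp add: minus_X_space.rep_eq)
    then show ?thesis unfolding wm by blast
  qed
  obtain v where v: "\<And>e. e > 0 \<Longrightarrow> \<exists>M. \<forall>n\<ge>M. \<forall>F. finite F \<longrightarrow> F \<noteq> {} \<longrightarrow>
              w F * (\<Sum>i\<in>F. norm (X_coord (u n) i - v i)) \<le> e"
    using weighted_sums_complete[of w "\<lambda>n. X_coord (u n)", OF w C] by blast
  obtain M where "\<forall>F. finite F \<longrightarrow> F \<noteq> {} \<longrightarrow> mean_sqrt F (\<lambda>i. X_coord (u M) i - v i) \<le> 1"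
    using v[of 1] by (auto simp: wm)
  then have "bdd_above ((\<lambda>F. mean_sqrt F (\<lambda>i. X_coord (u M) i - v i)) ` {F. finite F \<and> F \<noteq> {}})"
    by (auto intro!: bdd_aboveI[of _ 1])
  from bdd_mean_sqrt_mult[OF this, of "-1"]
  have "bdd_above ((\<lambda>F. mean_sqrt F (\<lambda>i. v i - X_coord (u M) i)) ` {F. finite F \<and> F \<noteq> {}})"
    by (simp add: algebra_simps)
  from bdd_mean_sqrt_add[OF this, of "X_coord (u M)"] X_coord[of "u M"]
  have "bdd_above ((\<lambda>F. mean_sqrt F v) ` {F. finite F \<and> F \<noteq> {}})" by simp
  then have V: "X_coord (Abs_X v) = v" by (simp add: Abs_X_inverse)
  have "u \<longlonglongrightarrow> Abs_X v"
  proof (rule metric_LIMSEQ_I)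
    fix e :: real assume e: "e > 0"
    then obtain M where M: "\<forall>n\<ge>M. \<forall>F. finite F \<longrightarrow> F \<noteq> {} \<longrightarrow>
        mean_sqrt F (\<lambda>i. X_coord (u n) i - v i) \<le> e / 2"
      using v[of "e / 2"] by (auto simp: wm)
    have "dist (u n) (Abs_X v) \<le> e / 2" if "n \<ge> M" for n
      unfolding dist_norm
      by (rule norm_X_leI) (use M that in \<open>auto simp: minus_X_space.rep_eq V\<close>)
    then show "\<exists>M. \<forall>n\<ge>M. dist (u n) (Abs_X v) < e" using e by fastforce
  qed
  then show "convergent u" unfolding convergent_def by blast
qed

lemma banach_over_scale_X: "banach_over (scale_X :: 'k::{real_normed_field,banach} \<Rightarrow> _)"
proof unfold_locales
  fix a b c :: 'k and x y :: "'k X_space" and r :: real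
  show "scale_X a (x + y) = scale_X a x + scale_X a y" "scale_X (a + b) x = scale_X a x + scale_X b x"
    "scale_X a (scale_X b x) = scale_X (a * b) x" "scale_X 1 x = x"
    by (transfer; auto simp: algebra_simps)+
  show "scale_X (of_real r) x = r *\<^sub>R x"
    by transfer (simp add: scaleR_conv_of_real)
  have le: "norm (scale_X c x) \<le> norm c * norm x" for c :: 'k and x
    by (rule norm_X_leI)
      (auto simp: scale_X.rep_eq mean_sqrt_mult intro!: mult_left_mono mean_sqrt_le_norm)
  show "norm (scale_X c x) = norm c * norm x"
  proof (cases "c = 0")
    case True
    then show ?thesis using le[of 0 x] by simp
  next
    case False
    have "scale_X (inverse c) (scale_X c x) = x"
      using False by transfer (simp add: mult.assoc[symmetric])
    then have "norm x \<le> norm (inverse c) * norm (scale_X c x)"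
      using le[of "inverse c" "scale_X c x"] by simp
    then have "norm c * norm x \<le> norm (scale_X c x)" 
      using False by (simp add: norm_inverse) (simp add: field_simps)
    then show ?thesis using le[of c x] by simp
  qed
qed

definition coord_functional :: "nat \<Rightarrow> 'k::real_normed_field X_space \<Rightarrow>\<^sub>L 'k" where
  "coord_functional n = Blinfun (\<lambda>x. X_coord x n)"


section \<open>The space of absolutely summable families\<close>

typedef (overloaded) ('g, 'k) ell1 =
  "{x :: 'g \<Rightarrow> 'k::real_normed_field. (\<lambda>\<gamma>. norm (x \<gamma>)) summable_on UNIV}"
  morphisms ell1_coord Abs_ell1
  by (rule exI[of _ "\<lambda>_. 0"]) simp

setup_lifting type_definition_ell1

lemma abs_summable_on_add:
  assumes "(\<lambda>\<gamma>. norm (x \<gamma> :: 'k::real_normed_vector)) summable_on UNIV" "(\<lambda>\<gamma>. norm (y \<gamma>)) summable_on UNIV"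
  shows "(\<lambda>\<gamma>. norm (x \<gamma> + y \<gamma>)) summable_on UNIV"
  by (rule summable_on_comparison_test[OF summable_on_add[OF assms]])
    (auto intro: norm_triangle_ineq)

lift_definition scale_ell1 :: "'k::real_normed_field \<Rightarrow> ('g, 'k) ell1 \<Rightarrow> ('g, 'k) ell1"
  is "\<lambda>c x \<gamma>. c * x \<gamma>"
  by (simp add: norm_mult summable_on_cmult_right)

instantiation ell1 :: (type, real_normed_field) real_normed_vector
begin

lift_definition zero_ell1 :: "('a, 'b) ell1" is "\<lambda>_. 0"
  by simp

lift_definition plus_ell1 :: "('a, 'b) ell1 \<Rightarrow> ('a, 'b) ell1 \<Rightarrow> ('a, 'b) ell1" is "\<lambda>x y \<gamma>. x \<gamma> + y \<gamma>"
  by (rule abs_summable_on_add)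

lift_definition uminus_ell1 :: "('a, 'b) ell1 \<Rightarrow> ('a, 'b) ell1" is "\<lambda>x \<gamma>. - x \<gamma>"
  by simp

lift_definition minus_ell1 :: "('a, 'b) ell1 \<Rightarrow> ('a, 'b) ell1 \<Rightarrow> ('a, 'b) ell1" is "\<lambda>x y \<gamma>. x \<gamma> - y \<gamma>"
  using abs_summable_on_add[of _ "\<lambda>\<gamma>. - _ \<gamma>"] by simp

lift_definition scaleR_ell1 :: "real \<Rightarrow> ('a, 'b) ell1 \<Rightarrow> ('a, 'b) ell1" is "\<lambda>r x \<gamma>. r *\<^sub>R x \<gamma>"
  by (simp add: summable_on_cmult_right)

lift_definition norm_ell1 :: "('a, 'b) ell1 \<Rightarrow> real" is "\<lambda>x. \<Sum>\<^sub>\<infinity>\<gamma>. norm (x \<gamma>)" .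

definition dist_ell1 :: "('a, 'b) ell1 \<Rightarrow> ('a, 'b) ell1 \<Rightarrow> real"
  where "dist_ell1 x y = norm (x - y)"

definition uniformity_ell1 :: "(('a, 'b) ell1 \<times> ('a, 'b) ell1) filter"
  where "uniformity_ell1 = (INF e\<in>{0 <..}. principal {(x, y). dist x y < e})"

definition open_ell1 :: "('a, 'b) ell1 set \<Rightarrow> bool"
  where "open_ell1 S = (\<forall>x\<in>S. \<forall>\<^sub>F (x', y) in uniformity. x' = x \<longrightarrow> y \<in> S)"

definition sgn_ell1 :: "('a, 'b) ell1 \<Rightarrow> ('a, 'b) ell1"
  where "sgn_ell1 x = scaleR (inverse (norm x)) x"

lemma sum_le_norm_ell1: "finite F \<Longrightarrow> (\<Sum>\<gamma>\<in>F. norm (ell1_coord x \<gamma>)) \<le> norm x"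
  by transfer (auto intro: finite_sum_le_infsum)

lemma norm_ell1_coord_le: "norm (ell1_coord x \<gamma>) \<le> norm x"
  using sum_le_norm_ell1[of "{\<gamma>}" x] by simp

lemma norm_ell1_leI:
  assumes "\<And>F. finite F \<Longrightarrow> (\<Sum>\<gamma>\<in>F. norm (ell1_coord x \<gamma>)) \<le> B"
  shows "norm x \<le> B"
  using assms by transfer (rule infsum_le_finite_sums, auto)

instance
proof
  fix x y z :: "('a, 'b) ell1" and r s :: real
  show "dist x y = norm (x - y)" by (rule dist_ell1_def)
  show "sgn x = inverse (norm x) *\<^sub>R x" by (rule sgn_ell1_def)
  show "uniformity = (INF e\<in>{0<..}. principal {(x::('a, 'b) ell1, y). dist x y < e})"
    by (rule uniformity_ell1_def)
  show "open S = (\<forall>x\<in>S. \<forall>\<^sub>F (x', y) in uniformity. x' = x \<longrightarrow> y \<in> S)" for S :: "('a, 'b) ell1 set"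
    by (rule open_ell1_def)
  show "x + y + z = x + (y + z)" "x + y = y + x" "0 + x = x" "- x + x = 0" "x - y = x + - y"
    by (transfer; auto simp: algebra_simps)+
  show "r *\<^sub>R (x + y) = r *\<^sub>R x + r *\<^sub>R y" "(r + s) *\<^sub>R x = r *\<^sub>R x + s *\<^sub>R x"
    "r *\<^sub>R s *\<^sub>R x = (r * s) *\<^sub>R x" "1 *\<^sub>R x = x"
    by (transfer; auto simp: algebra_simps)+
  show "norm x = 0 \<longleftrightarrow> x = 0"
  proof
    assume "norm x = 0"
    then have "ell1_coord x \<gamma> = 0" for \<gamma> using norm_ell1_coord_le[of x \<gamma>] by simp
    then show "x = 0" by transfer auto
  next
    assume "x = 0"
    then show "norm x = 0" by transfer simp
  qed
  show "norm (x + y) \<le> norm x + norm y"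
  proof (rule norm_ell1_leI)
    fix F :: "'a set" assume F: "finite F"
    have "(\<Sum>\<gamma>\<in>F. norm (ell1_coord (x + y) \<gamma>))
        \<le> (\<Sum>\<gamma>\<in>F. norm (ell1_coord x \<gamma>)) + (\<Sum>\<gamma>\<in>F. norm (ell1_coord y \<gamma>))"
      by (simp add: sum.distrib[symmetric] sum_mono norm_triangle_ineq plus_ell1.rep_eq)
    then show "(\<Sum>\<gamma>\<in>F. norm (ell1_coord (x + y) \<gamma>)) \<le> norm x + norm y"
      using sum_le_norm_ell1[OF F, of x] sum_le_norm_ell1[OF F, of y] by simp
  qed
  show "norm (r *\<^sub>R x) = \<bar>r\<bar> * norm x"
    by transfer (simp add: infsum_cmult_right')
qed

end

instance ell1 :: (type, "{real_normed_field,banach}") banach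
proof
  fix u :: "nat \<Rightarrow> ('a, 'b) ell1"
  assume "Cauchy u"
  have C: "\<exists>M. \<forall>m\<ge>M. \<forall>n\<ge>M. \<forall>F. finite F \<longrightarrow> F \<noteq> {} \<longrightarrow>
              1 * (\<Sum>i\<in>F. norm (ell1_coord (u m) i - ell1_coord (u n) i)) \<le> e" if "e > 0" for e :: real
  proof -
    obtain M where "\<forall>m\<ge>M. \<forall>n\<ge>M. dist (u m) (u n) < e"
      using metric_CauchyD[OF \<open>Cauchy u\<close> \<open>e > 0\<close>] by blast
    then have M: "norm (u m - u n) \<le> e" if "m \<ge> M" "n \<ge> M" for m n
      using that by (simp add: dist_norm less_imp_le)
    have "1 * (\<Sum>i\<in>F. norm (ell1_coord (u m) i - ell1_coord (u n) i)) \<le> e"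
      if "m \<ge> M" "n \<ge> M" "finite F" for m n F
      using order_trans[OF sum_le_norm_ell1[OF that(3), of "u m - u n"] M[OF that(1,2)]]
      by (simp add: minus_ell1.rep_eq)
    then show ?thesis by blast
  qed
  obtain v where v: "\<And>e::real. e > 0 \<Longrightarrow> \<exists>M. \<forall>n\<ge>M. \<forall>F. finite F \<longrightarrow> F \<noteq> {} \<longrightarrow>
              1 * (\<Sum>i\<in>F. norm (ell1_coord (u n) i - v i)) \<le> e"
    using weighted_sums_complete[of "\<lambda>_. 1" "\<lambda>n. ell1_coord (u n)", OF _ C] by auto
  obtain M where M: "\<forall>F. finite F \<longrightarrow> F \<noteq> {} \<longrightarrow> (\<Sum>i\<in>F. norm (ell1_coord (u M) i - v i)) \<le> 1"
    using v[of 1] by auto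
  have "(\<lambda>i. norm (ell1_coord (u M) i - v i)) summable_on UNIV"
  proof (rule nonneg_bdd_above_summable_on)
    have "(\<Sum>i\<in>F. norm (ell1_coord (u M) i - v i)) \<le> 1" if "finite F" for F
      using M that by (cases "F = {}") auto
    then show "bdd_above (sum (\<lambda>i. norm (ell1_coord (u M) i - v i)) ` {F. F \<subseteq> UNIV \<and> finite F})"
      by (auto intro!: bdd_aboveI[of _ 1])
  qed simp
  then have "(\<lambda>i. norm (v i - ell1_coord (u M) i)) summable_on UNIV"
    by (simp add: norm_minus_commute)
  from abs_summable_on_add[OF this, of "ell1_coord (u M)"] ell1_coord[of "u M"]
  have "(\<lambda>i. norm (v i)) summable_on UNIV" by simp
  then have V: "ell1_coord (Abs_ell1 v) = v" by (simp add: Abs_ell1_inverse)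
  have "u \<longlonglongrightarrow> Abs_ell1 v"
  proof (rule metric_LIMSEQ_I)
    fix e :: real assume e: "e > 0"
    then obtain M where M: "\<forall>n\<ge>M. \<forall>F. finite F \<longrightarrow> F \<noteq> {} \<longrightarrow>
        (\<Sum>i\<in>F. norm (ell1_coord (u n) i - v i)) \<le> e / 2"
      using v[of "e / 2"] by auto
    have "dist (u n) (Abs_ell1 v) \<le> e / 2" if "n \<ge> M" for n
      unfolding dist_norm
    proof (rule norm_ell1_leI)
      fix F :: "'a set" assume "finite F"
      then show "(\<Sum>i\<in>F. norm (ell1_coord (u n - Abs_ell1 v) i)) \<le> e / 2"
        using M that e by (cases "F = {}") (auto simp: minus_ell1.rep_eq V)
    qed
    then show "\<exists>M. \<forall>n\<ge>M. dist (u n) (Abs_ell1 v) < e" using e by fastforce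
  qed
  then show "convergent u" unfolding convergent_def by blast
qed

lemma banach_over_scale_ell1:
  "banach_over (scale_ell1 :: 'k::{real_normed_field,banach} \<Rightarrow> ('g, 'k) ell1 \<Rightarrow> _)"
proof unfold_locales
  fix a b c :: 'k and x y :: "('g, 'k) ell1" and r :: real
  show "scale_ell1 a (x + y) = scale_ell1 a x + scale_ell1 a y"
    "scale_ell1 (a + b) x = scale_ell1 a x + scale_ell1 b x"
    "scale_ell1 a (scale_ell1 b x) = scale_ell1 (a * b) x" "scale_ell1 1 x = x"
    by (transfer; auto simp: algebra_simps)+
  show "scale_ell1 (of_real r) x = r *\<^sub>R x"
    by transfer (simp add: scaleR_conv_of_real)
  show "norm (scale_ell1 c x) = norm c * norm x"
    by transfer (simp add: norm_mult infsum_cmult_right')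
qed

text \<open>
  For a set \<open>\<Gamma>\<close> of elements of a type \<open>'g\<close>, the space \<open>\<ell>\<^sub>1(\<Gamma>)\<close> consists of the families
  vanishing outside \<open>\<Gamma>\<close>; on them \<^term>\<open>norm\<close> is the sum over \<open>\<Gamma>\<close>. Passing to subsets of the type
  includes the case of empty \<open>\<Gamma>\<close>.
\<close>

definition ell1_on :: "'g set \<Rightarrow> ('g, 'k::real_normed_field) ell1 set" where
  "ell1_on \<Gamma> = {x. \<forall>\<gamma>. \<gamma> \<notin> \<Gamma> \<longrightarrow> ell1_coord x \<gamma> = 0}"

lemma norm_ell1_on:
  assumes "x \<in> ell1_on \<Gamma>"
  shows "norm x = (\<Sum>\<^sub>\<infinity>\<gamma>\<in>\<Gamma>. norm (ell1_coord x \<gamma>))"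
  unfolding norm_ell1.rep_eq
  by (rule infsum_cong_neutral) (use assms in \<open>auto simp: ell1_on_def\<close>)

end

theory Submission
  imports Defs
begin

text \<open>
  Everything follows from one feature of the norm of \<open>X\<close>: a sum of \<open>N\<close> distinct unit vectors, or of \<open>N\<close>
  distinct coordinate functionals, with coefficients of modulus at most \<open>1\<close>, has norm at most
  \<open>\<surd>N\<close>.

  If a bounded functional \<open>\<phi>\<close> takes values of modulus at least \<open>e\<close> on infinitely many members of a
  sequence with this property, then rotating the coefficients makes \<open>\<phi>\<close> at least \<open>N e\<close> on a sum of
  \<open>N\<close> members, against the bound \<open>\<parallel>\<phi>\<parallel> \<surd>N\<close>. So every such sequence is weakly null
  (\<open>tendsto_zero_if_combinations_le_sqrt\<close>). Applied to the coordinate functionals, this is the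
  weak convergence in the dual space.

  For a subsequence \<open>r\<close>, let \<open>x\<close> have the entry \<open>1 / \<surd>(k + 1)\<close> at \<open>r k\<close> and zeros elsewhere.
  It belongs to \<open>X\<close>, but its first \<open>N\<close> entries along \<open>r\<close> have sum at least \<open>\<surd>N\<close>. A vector at
  distance \<open>d < 1\<close> from \<open>x\<close> therefore has sum at least \<open>(1 - d) \<surd>N\<close> on these places, so it is not
  absolutely summable along \<open>r\<close>, and the space in the definition of strong normality misses a ball.

  Finally, let \<open>T\<close> be an isomorphism of \<open>X\<close> onto \<open>\<ell>\<^sub>1(\<Gamma>)\<close>. The images of the unit vectors are
  bounded away from \<open>0\<close>, and they tend to \<open>0\<close> in each coordinate, since the unit vectors are weakly
  null. In \<open>\<ell>\<^sub>1\<close> the norm is asymptotically additive along coordinatewise null sequences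
  (\<open>ell1_norm_add_almost_additive\<close>), so for each \<open>N\<close> some sum of \<open>N\<close> distinct images has norm
  at least a fixed multiple of \<open>N\<close>. This contradicts the bound \<open>\<parallel>T\<parallel> \<surd>N\<close>.
\<close>

section \<open>Sequences whose combinations grow like square roots\<close>

lemma sqrt_less_linear:
  assumes e: "(e::real) > 0"
  obtains N :: nat where "B * sqrt N < e * N"
proof -
  obtain N :: nat where N: "real N > (B / e)\<^sup>2" using reals_Archimedean2 by blast
  then have N0: "sqrt N > 0" using order.strict_trans1[OF zero_le_power2 N] by simp
  have "B / e < sqrt N" using N by (rule real_less_rsqrt)
  then have "B < e * sqrt N" using e by (simp add: field_simps)
  then have "B * sqrt N < e * sqrt N * sqrt N" using N0 by (rule mult_strict_right_mono)
  then show thesis by (intro that[of N]) (simp add: mult.assoc)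
qed

text \<open>
  If \<open>N\<close> entries had norm at least \<open>e\<close>, their norms would sum to at least \<open>e N\<close>, which exceeds
  \<open>B \<surd>N\<close> for large \<open>N\<close>; so for each \<open>e\<close> the number of such entries is finite.
\<close>

lemma tendsto_zero_if_sums_le_sqrt:
  fixes a :: "nat \<Rightarrow> 'a::real_normed_vector"
  assumes B: "\<And>F. finite F \<Longrightarrow> (\<Sum>n\<in>F. norm (a n)) \<le> B * sqrt (card F)"
  shows "a \<longlonglongrightarrow> 0"
proof (rule LIMSEQ_I)
  fix e :: real assume e: "e > 0"
  have "finite {n. norm (a n) \<ge> e}"
  proof (rule ccontr)
    assume inf: "infinite {n. norm (a n) \<ge> e}"
    obtain N where N: "B * sqrt (real N) < e * real N" by (rule sqrt_less_linear[OF e])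
    obtain F where F: "F \<subseteq> {n. norm (a n) \<ge> e}" "finite F" "card F = N"
      by (metis infinite_arbitrarily_large[OF inf])
    have "e * real N = (\<Sum>n\<in>F. e)" using F(3) by simp
    also have "\<dots> \<le> (\<Sum>n\<in>F. norm (a n))" using F(1) by (intro sum_mono) auto
    also have "\<dots> \<le> B * sqrt N" using B[OF F(2)] F(3) by simp
    finally show False using N by simp
  qed
  then obtain M where M: "\<forall>n\<in>{n. norm (a n) \<ge> e}. n < M"
    unfolding finite_nat_set_iff_bounded by (elim exE)
  have "norm (a n - 0) < e" if "n \<ge> M" for n
    using M that by (force simp: not_le)
  then show "\<exists>M. \<forall>n\<ge>M. norm (a n - 0) < e" by blast
qed

lemma exists_phase:
  fixes a :: "'k::real_normed_field"
  shows "\<exists>c. norm c \<le> 1 \<and> c * a = of_real (norm a)"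
proof (cases "a = 0")
  case True
  then show ?thesis by (intro exI[of _ 0]) auto
next
  case False
  then show ?thesis by (intro exI[of _ "of_real (norm a) / a"]) (auto simp: norm_divide)
qed

text \<open>
  This is how weak convergence to zero is obtained: \<open>a n\<close> is the value of a bounded functional at the
  \<open>n\<close>-th vector, and the bound on its combinations comes from the bound on the norm of the same
  combinations of the vectors. Rotating every \<open>a n\<close> onto the positive half-line turns the sum of
  norms into such a combination.
\<close>

lemma tendsto_zero_if_combinations_le_sqrt:
  fixes a :: "nat \<Rightarrow> 'k::real_normed_field"
  assumes B: "\<And>F c. finite F \<Longrightarrow> (\<And>n. norm (c n) \<le> 1) \<Longrightarrow>
    norm (\<Sum>n\<in>F. c n * a n) \<le> B * sqrt (card F)"
  shows "a \<longlonglongrightarrow> 0"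
proof (rule tendsto_zero_if_sums_le_sqrt)
  fix F :: "nat set" assume F: "finite F"
  obtain c where c: "\<And>n. norm (c n) \<le> 1" "\<And>n. c n * a n = of_real (norm (a n))"
    using exists_phase[of "a _"] by metis
  have "(\<Sum>n\<in>F. norm (a n)) = norm (\<Sum>n\<in>F. c n * a n)"
    unfolding c(2) of_real_sum[symmetric] norm_of_real by (simp add: sum_nonneg)
  also have "\<dots> \<le> B * sqrt (card F)" using B[OF F c(1)] .
  finally show "(\<Sum>n\<in>F. norm (a n)) \<le> B * sqrt (card F)" .
qed

section \<open>Vectors of \<open>X\<close>\<close>

lemma sum_coord_le: "finite F \<Longrightarrow> (\<Sum>n\<in>F. norm (X_coord x n)) \<le> sqrt (card F) * norm x"
  using mean_sqrt_le_norm[of F x]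
  by (cases "F = {}") (auto simp: mean_sqrt_def divide_le_eq card_gt_0_iff mult.commute)

lemma X_coord_Abs_X:
  fixes x :: "nat \<Rightarrow> 'k::real_normed_field"
  assumes B: "\<And>F. finite F \<Longrightarrow> (\<Sum>n\<in>F. norm (x n)) \<le> B * sqrt (card F)"
  shows "X_coord (Abs_X x) = x"
proof -
  have "mean_sqrt F x \<le> B" if "finite F" "F \<noteq> {}" for F
    using B[OF that(1)] that by (auto simp: mean_sqrt_def divide_le_eq card_gt_0_iff mult.commute)
  then show ?thesis by (intro Abs_X_inverse) (auto intro!: bdd_aboveI[of _ B])
qed

lemma X_coord_sum: "X_coord (\<Sum>i\<in>F. f i) n = (\<Sum>i\<in>F. X_coord (f i) n)"
  by (induction F rule: infinite_finite_induct) (auto simp: zero_X_space.rep_eq plus_X_space.rep_eq)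

definition unit_X :: "nat \<Rightarrow> 'k::real_normed_field X_space" where
  "unit_X m = Abs_X (\<lambda>n. if n = m then 1 else 0)"

lemma X_coord_unit_X: "X_coord (unit_X m :: 'k::real_normed_field X_space) = (\<lambda>n. if n = m then 1 else 0)"
  unfolding unit_X_def
proof (rule X_coord_Abs_X)
  fix F :: "nat set" assume F: "finite F"
  have "(\<Sum>n\<in>F. norm (if n = m then 1 else 0 :: 'k)) = (\<Sum>n\<in>F. if n = m then 1 else 0)"
    by (intro sum.cong) auto
  also have "\<dots> = (if m \<in> F then 1 else 0)" using F by (simp add: sum.delta)
  also have "\<dots> \<le> 1 * sqrt (card F)" using F by (auto simp: Suc_le_eq card_gt_0_iff)
  finally show "(\<Sum>n\<in>F. norm (if n = m then 1 else 0 :: 'k)) \<le> 1 * sqrt (card F)" .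
qed

text \<open>
  On \<open>G\<close> the entries of the combination sum to at most \<open>card (G \<inter> F)\<close>, and this number is at most the
  geometric mean of \<open>card G\<close> and \<open>card F\<close>; dividing by \<open>\<surd>(card G)\<close> leaves \<open>\<surd>(card F)\<close>.
\<close>

lemma norm_sum_unit_X_le:
  fixes c :: "nat \<Rightarrow> 'k::real_normed_field"
  assumes F: "finite F" and c: "\<And>n. norm (c n) \<le> 1"
  shows "norm (\<Sum>n\<in>F. scale_X (c n) (unit_X n)) \<le> sqrt (card F)"
proof (rule norm_X_leI)
  fix G :: "nat set" assume G: "finite G" "G \<noteq> {}"
  have "X_coord (\<Sum>n\<in>F. scale_X (c n) (unit_X n)) = (\<lambda>n. if n \<in> F then c n else 0)"
    using F by (auto simp: X_coord_sum scale_X.rep_eq X_coord_unit_X if_distrib fun_eq_iff cong: if_cong)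
  then have "(\<Sum>n\<in>G. norm (X_coord (\<Sum>n\<in>F. scale_X (c n) (unit_X n)) n))
      = (\<Sum>n\<in>G \<inter> F. norm (c n))"
    using G by (simp add: if_distrib sum.inter_restrict cong: if_cong)
  also have "\<dots> \<le> real (card (G \<inter> F))" using sum_mono[of "G \<inter> F" "\<lambda>n. norm (c n)" "\<lambda>_. 1"] c by simp
  also have "\<dots> = sqrt (card (G \<inter> F)) * sqrt (card (G \<inter> F))" by simp
  also have "\<dots> \<le> sqrt (card G) * sqrt (card F)"
    using F G by (intro mult_mono) (auto intro: card_mono)
  finally show "mean_sqrt G (X_coord (\<Sum>n\<in>F. scale_X (c n) (unit_X n))) \<le> sqrt (card F)"
    using G by (simp add: mean_sqrt_def divide_le_eq card_gt_0_iff mult.commute)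
qed

lemma norm_unit_X: "norm (unit_X n :: 'k::real_normed_field X_space) = 1"
proof (rule antisym)
  have "scale_X 1 x = x" for x :: "'k X_space" by transfer simp
  then show "norm (unit_X n :: 'k X_space) \<le> 1"
    using norm_sum_unit_X_le[of "{n}" "\<lambda>_. 1 :: 'k"] by simp
  show "norm (unit_X n :: 'k X_space) \<ge> 1"
    using norm_X_coord_le[of "unit_X n :: 'k X_space" n] by (simp add: X_coord_unit_X)
qed

section \<open>Weak convergence of the coordinate functionals\<close>

lemma coord_functional_apply: "coord_functional n x = X_coord x n"
proof -
  have "bounded_linear (\<lambda>x :: 'a X_space. X_coord x n)"
    by (rule bounded_linear_intro[of _ 1])
      (auto simp: plus_X_space.rep_eq scaleR_X_space.rep_eq norm_X_coord_le)
  then show ?thesis by (simp add: coord_functional_def bounded_linear_Blinfun_apply)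
qed

lemma norm_coord_functional: "norm (coord_functional n :: 'k::real_normed_field X_space \<Rightarrow>\<^sub>L 'k) = 1"
proof (rule antisym)
  show "norm (coord_functional n :: 'k X_space \<Rightarrow>\<^sub>L 'k) \<le> 1"
    by (rule norm_blinfun_bound) (auto simp: coord_functional_apply norm_X_coord_le)
  show "norm (coord_functional n :: 'k X_space \<Rightarrow>\<^sub>L 'k) \<ge> 1"
    using norm_blinfun[of "coord_functional n :: 'k X_space \<Rightarrow>\<^sub>L 'k" "unit_X n"]
    by (simp add: coord_functional_apply X_coord_unit_X norm_unit_X)
qed

lemma coord_functional_in_dual_space: "coord_functional n \<in> dual_space scale_X"
  by (simp add: dual_space_def coord_functional_apply scale_X.rep_eq)

lemma norm_sum_coord_functional_le:
  fixes c :: "nat \<Rightarrow> 'k::{real_normed_field,banach}"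
  assumes F: "finite F" and c: "\<And>n. norm (c n) \<le> 1"
  shows "norm (\<Sum>n\<in>F. scale_dual (c n) (coord_functional n)) \<le> sqrt (card F)"
proof (rule norm_blinfun_bound)
  fix x :: "'k X_space"
  have "norm ((\<Sum>n\<in>F. scale_dual (c n) (coord_functional n)) x) = norm (\<Sum>n\<in>F. c n * X_coord x n)"
    by (simp add: blinfun.sum_left scale_dual_apply coord_functional_apply)
  also have "\<dots> \<le> (\<Sum>n\<in>F. norm (X_coord x n))"
    by (rule sum_norm_le) (simp add: norm_mult c mult_left_le_one_le)
  also have "\<dots> \<le> sqrt (card F) * norm x" by (rule sum_coord_le[OF F])
  finally show "norm ((\<Sum>n\<in>F. scale_dual (c n) (coord_functional n)) x) \<le> sqrt (card F) * norm x" .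
qed simp

lemma bidual_space_sum:
  assumes \<phi>: "\<phi> \<in> bidual_space smul" and f: "\<And>i. i \<in> F \<Longrightarrow> f i \<in> dual_space smul"
  shows "(\<Sum>i\<in>F. scale_dual (c i) (f i)) \<in> dual_space smul \<and>
    \<phi> (\<Sum>i\<in>F. scale_dual (c i) (f i)) = (\<Sum>i\<in>F. c i * \<phi> (f i))"
proof -
  have add: "\<phi> (g + h) = \<phi> g + \<phi> h" if "g \<in> dual_space smul" "h \<in> dual_space smul" for g h
    using \<phi> that by (auto simp: bidual_space_def)
  have scale: "\<phi> (scale_dual a g) = a * \<phi> g" if "g \<in> dual_space smul" for a g
    using \<phi> that by (auto simp: bidual_space_def)
  have 0: "0 \<in> dual_space smul" by (simp add: dual_space_def)
  have "scale_dual 0 0 = (0 :: 'a \<Rightarrow>\<^sub>L 'b)" by (rule blinfun_eqI) (simp add: scale_dual_apply)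
  then have "\<phi> 0 = 0" using scale[OF 0, of 0] by simp
  moreover have "scale_dual a g \<in> dual_space smul" if "g \<in> dual_space smul" for a g
    using that by (auto simp: dual_space_def scale_dual_apply)
  moreover have "g + h \<in> dual_space smul" if "g \<in> dual_space smul" "h \<in> dual_space smul" for g h
    using that by (auto simp: dual_space_def blinfun.add_left distrib_left)
  ultimately show ?thesis using f
    by (induction F rule: infinite_finite_induct) (simp_all add: 0 add scale)
qed

text \<open>
  The restriction to the bidual in the evaluation map is essential here: it makes the limit
  extensional, as convergence in the product topology demands.
\<close>

lemma limitin_weak_topology_dual:
  assumes l: "l \<in> dual_space smul" and f: "\<And>n. f n \<in> dual_space smul"
    and lim: "\<And>\<phi>. \<phi> \<in> bidual_space smul \<Longrightarrow> ((\<lambda>n. \<phi> (f n)) \<longlongrightarrow> \<phi> l) F"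
  shows "limitin (weak_topology_dual smul) f l F"
proof -
  let ?ev = "\<lambda>f. \<lambda>\<phi>\<in>bidual_space smul. \<phi> f"
  let ?P = "product_topology (\<lambda>_. euclidean) (bidual_space smul)"
  have P: "limitin ?P (\<lambda>n. ?ev (f n)) (?ev l) F"
    using lim by (auto simp: limitin_componentwise)
  show ?thesis
    unfolding limitin_def weak_topology_dual_def
  proof safe
    show "l \<in> topspace (pullback_topology (dual_space smul) ?ev ?P)"
      using l by (simp add: topspace_pullback_topology)
    fix U assume "openin (pullback_topology (dual_space smul) ?ev ?P) U" and lU: "l \<in> U"
    then obtain V where V: "openin ?P V" "U = ?ev -` V \<inter> dual_space smul"
      by (auto simp: openin_pullback_topology)
    then have "\<forall>\<^sub>F n in F. ?ev (f n) \<in> V" using P lU by (auto simp: limitin_def)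
    then show "\<forall>\<^sub>F n in F. f n \<in> U" by eventually_elim (use V f in auto)
  qed
qed

lemma coord_functional_weakly_null:
  "limitin (weak_topology_dual (scale_X :: 'k::{real_normed_field,banach} \<Rightarrow> _)) coord_functional 0 sequentially"
proof (rule limitin_weak_topology_dual)
  show zero: "0 \<in> dual_space (scale_X :: 'k \<Rightarrow> _)" by (simp add: dual_space_def)
  show "coord_functional n \<in> dual_space (scale_X :: 'k \<Rightarrow> _)" for n
    by (rule coord_functional_in_dual_space)
  fix \<phi> assume \<phi>: "\<phi> \<in> bidual_space (scale_X :: 'k \<Rightarrow> _)"
  note sum = bidual_space_sum[where f = coord_functional, OF \<phi> coord_functional_in_dual_space]
  obtain B where B: "\<forall>f\<in>dual_space scale_X. norm (\<phi> f) \<le> B * norm f"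
    using \<phi> unfolding bidual_space_def mem_Collect_eq by (elim conjE exE) rule
  have "(\<lambda>n. \<phi> (coord_functional n)) \<longlonglongrightarrow> 0"
  proof (rule tendsto_zero_if_combinations_le_sqrt[of _ "\<bar>B\<bar>"])
    fix F :: "nat set" and c :: "nat \<Rightarrow> 'k"
    assume F: "finite F" and c: "\<And>n. norm (c n) \<le> 1"
    let ?g = "\<Sum>n\<in>F. scale_dual (c n) (coord_functional n)"
    have "norm (\<Sum>n\<in>F. c n * \<phi> (coord_functional n)) \<le> B * norm ?g"
      using B[rule_format, of ?g] sum[where F = F and c = c] by simp
    also have "\<dots> \<le> \<bar>B\<bar> * sqrt (card F)"
      using norm_sum_coord_functional_le[OF F c] by (intro mult_mono) auto
    finally show "norm (\<Sum>n\<in>F. c n * \<phi> (coord_functional n)) \<le> \<bar>B\<bar> * sqrt (card F)" .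
  qed
  moreover have "\<phi> 0 = 0" using sum[where F = "{}"] by simp
  ultimately show "(\<lambda>n. \<phi> (coord_functional n)) \<longlonglongrightarrow> \<phi> 0" by simp
qed

section \<open>Strong normality fails along every subsequence\<close>

text \<open>
  Among all sets of \<open>m\<close> indices the initial segment has the largest sum, which is at most
  \<open>2 \<surd>m\<close> by comparison with an integral. Inserting the elements in increasing order gives both at once:
  the new element \<open>b\<close> is at least the number of elements before it, so its term is at most the increment
  of \<open>2 \<surd>m\<close>.
\<close>

lemma sum_inverse_sqrt_le:
  fixes K :: "nat set"
  assumes "finite K"
  shows "(\<Sum>k\<in>K. 1 / sqrt (real (Suc k))) \<le> 2 * sqrt (card K)"
  using assms
proof (induction rule: finite_linorder_max_induct)
  case empty
  then show ?case by simp
next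
  case (insert b A)
  have "card A \<le> b" using insert(2) card_mono[of "{..<b}" A] by auto
  then have "1 / sqrt (real (Suc b)) \<le> 1 / sqrt (real (Suc (card A)))"
    by (intro divide_left_mono) auto
  also have "\<dots> \<le> 2 * (sqrt (real (Suc (card A))) - sqrt (card A))"
  proof -
    define s t where "s = sqrt (real (Suc (card A)))" and "t = sqrt (card A)"
    have "s > 0" "t \<ge> 0" "t \<le> s" "s * s = t * t + 1" by (auto simp: s_def t_def)
    moreover have "2 * (s * t) \<le> s * s + t * t" using sum_squares_bound[of s t] by (simp add: power2_eq_square)
    ultimately have "1 / s \<le> 2 * (s - t)" by (simp add: field_simps)
    then show ?thesis by (simp add: s_def t_def)
  qed
  finally show ?case using insert by auto
qed

lemma sum_inverse_sqrt_ge: "(\<Sum>k<N. 1 / sqrt (real (Suc k))) \<ge> sqrt N"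
proof (cases "N = 0")
  case False
  have "sqrt N = real N * (1 / sqrt N)" by (simp add: real_div_sqrt)
  also have "\<dots> = (\<Sum>k<N. 1 / sqrt N)" by simp
  also have "\<dots> \<le> (\<Sum>k<N. 1 / sqrt (real (Suc k)))"
    using False by (intro sum_mono divide_left_mono) auto
  finally show ?thesis .
qed simp

text \<open>
  The vector that is zero off the range of \<open>r\<close> has these entries. It lies in \<open>X\<close>, because summing
  its entries over \<open>F\<close> amounts to summing \<open>1 / \<surd>(k + 1)\<close> over the preimage of \<open>F\<close>, a set no larger
  than \<open>F\<close>.
\<close>

lemma exists_inverse_sqrt_along:
  assumes r: "inj r"
  obtains x :: "'k::real_normed_field X_space" where "\<And>k. norm (X_coord x (r k)) = 1 / sqrt (real (Suc k))"
proof -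
  define x :: "nat \<Rightarrow> 'k" where "x n = (if n \<in> range r then of_real (1 / sqrt (real (Suc (inv r n)))) else 0)" for n
  have nx: "norm (x (r k)) = 1 / sqrt (real (Suc k))" for k
    using r by (simp add: x_def norm_divide)
  have "(\<Sum>n\<in>F. norm (x n)) \<le> 2 * sqrt (card F)" if F: "finite F" for F
  proof -
    have fin: "finite (r -` F)" using F r by (rule finite_vimageI)
    have "(\<Sum>n\<in>F. norm (x n)) = (\<Sum>n\<in>r ` (r -` F). norm (x n))"
      using F by (intro sum.mono_neutral_right) (auto simp: x_def)
    also have "\<dots> = (\<Sum>k\<in>r -` F. 1 / sqrt (real (Suc k)))"
      using r by (subst sum.reindex) (auto simp: nx inj_on_def)
    also have "\<dots> \<le> 2 * sqrt (card (r -` F))" by (rule sum_inverse_sqrt_le[OF fin])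
    also have "card (r -` F) \<le> card F" using F r by (intro card_inj_on_le[of r]) (auto simp: inj_on_def)
    finally show ?thesis by simp
  qed
  from X_coord_Abs_X[OF this] show thesis by (intro that[of "Abs_X x"]) (simp add: nx)
qed

text \<open>
  The norm of \<open>z - x\<close> controls the sum of its entries at \<open>r 0, \<dots>, r (N - 1)\<close> by
  \<open>\<surd>N \<parallel>z - x\<parallel>\<close>, whereas the entries of \<open>x\<close> sum to at least \<open>\<surd>N\<close> there. Hence a vector \<open>z\<close> that is
  summable along \<open>r\<close> is at distance at least \<open>1\<close> from \<open>x\<close>.
\<close>

lemma coord_functional_not_strongly_normal:
  fixes r :: "nat \<Rightarrow> nat"
  assumes r: "inj r"
  shows "\<not> strongly_normal (scale_X :: 'k::{real_normed_field,banach} \<Rightarrow> _) (coord_functional \<circ> r)"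
proof
  assume "strongly_normal (scale_X :: 'k \<Rightarrow> _) (coord_functional \<circ> r)"
  then have dense: "closure {x :: 'k X_space. summable (\<lambda>k. norm (X_coord x (r k)))} = UNIV"
    by (simp add: strongly_normal_def coord_functional_apply)
  obtain x :: "'k X_space" where x: "\<And>k. norm (X_coord x (r k)) = 1 / sqrt (real (Suc k))"
    using exists_inverse_sqrt_along[OF r] by blast
  obtain z where z: "summable (\<lambda>k. norm (X_coord z (r k)))" and d: "dist z x < 1"
    using dense closure_approachable[of x] by (metis (mono_tags) UNIV_I mem_Collect_eq zero_less_one)
  define C where "C = (\<Sum>k. norm (X_coord z (r k)))"
  have bound: "sqrt (real N) * (1 - dist z x) \<le> C" for N
  proof -
    have "sqrt (real N) \<le> (\<Sum>k<N. norm (X_coord x (r k)))"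
      using sum_inverse_sqrt_ge[of N] by (simp add: x)
    also have "\<dots> \<le> (\<Sum>k<N. norm (X_coord (z - x) (r k)) + norm (X_coord z (r k)))"
      by (intro sum_mono)
        (metis minus_X_space.rep_eq norm_minus_commute norm_triangle_sub add.commute)
    also have "\<dots> = (\<Sum>n\<in>r ` {..<N}. norm (X_coord (z - x) n)) + (\<Sum>k<N. norm (X_coord z (r k)))"
      using r by (subst sum.reindex) (auto simp: sum.distrib inj_on_def)
    also have "(\<Sum>n\<in>r ` {..<N}. norm (X_coord (z - x) n)) \<le> sqrt N * dist z x"
      using sum_coord_le[of "r ` {..<N}" "z - x"] r
      by (simp add: card_image inj_on_subset dist_norm)
    also have "(\<Sum>k<N. norm (X_coord z (r k))) \<le> C"
      unfolding C_def using z by (intro sum_le_suminf) auto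
    finally show ?thesis by (simp add: algebra_simps)
  qed
  obtain N :: nat where N: "C * sqrt N < (1 - dist z x) * N" using sqrt_less_linear[of "1 - dist z x" C] d by auto
  have "(1 - dist z x) * N = sqrt N * (1 - dist z x) * sqrt N" by simp
  also have "\<dots> \<le> C * sqrt N" by (intro mult_right_mono bound) simp
  finally show False using N by simp
qed

section \<open>Non-embeddability into spaces of absolutely summable families\<close>

text \<open>
  Up to \<open>e / 4\<close>, the norm of \<open>y\<close> lives on a finite set \<open>G\<close>. For large \<open>n\<close> the vector \<open>v n\<close> has mass
  less than \<open>e / 4\<close> on \<open>G\<close>, so \<open>y\<close> and \<open>v n\<close> are almost disjointly supported. Each of the two small
  masses is lost twice: once in the norm of its own vector and once as a perturbation of the other.
\<close>

lemma ell1_norm_add_almost_additive: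
  fixes y :: "('g, 'k::real_normed_field) ell1" and v :: "nat \<Rightarrow> ('g, 'k) ell1"
  assumes v: "\<And>\<gamma>. (\<lambda>n. ell1_coord (v n) \<gamma>) \<longlonglongrightarrow> 0" and e: "e > 0"
  shows "\<forall>\<^sub>F n in sequentially. norm (y + v n) \<ge> norm y + norm (v n) - e"
proof -
  have "(\<lambda>\<gamma>. norm (ell1_coord y \<gamma>)) summable_on UNIV" using ell1_coord[of y] by simp
  then obtain G where G: "finite G"
      and Gy: "dist (\<Sum>\<gamma>\<in>G. norm (ell1_coord y \<gamma>)) (norm y) \<le> e / 4"
    using infsum_finite_approximation[of "\<lambda>\<gamma>. norm (ell1_coord y \<gamma>)" UNIV "e / 4"] e
    by (auto simp: norm_ell1.rep_eq)
  have "(\<lambda>n. \<Sum>\<gamma>\<in>G. norm (ell1_coord (v n) \<gamma>)) \<longlonglongrightarrow> (\<Sum>\<gamma>\<in>G. 0)"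
    by (intro tendsto_sum tendsto_norm_zero v)
  then have "\<forall>\<^sub>F n in sequentially. (\<Sum>\<gamma>\<in>G. norm (ell1_coord (v n) \<gamma>)) < e / 4"
    using e by (intro order_tendstoD(2)[where y = 0]) auto
  then show ?thesis
  proof eventually_elim
    fix n assume n: "(\<Sum>\<gamma>\<in>G. norm (ell1_coord (v n) \<gamma>)) < e / 4"
    have sm: "(\<lambda>\<gamma>. norm (ell1_coord u \<gamma>)) summable_on A" for u :: "('g, 'k) ell1" and A
      using ell1_coord[of u] by (auto intro: summable_on_subset_banach)
    have split: "norm u = (\<Sum>\<gamma>\<in>G. norm (ell1_coord u \<gamma>)) + (\<Sum>\<^sub>\<infinity>\<gamma>\<in>-G. norm (ell1_coord u \<gamma>))"
      for u :: "('g, 'k) ell1"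
      using infsum_Un_disjoint[OF sm[of u G] sm[of u "-G"]] G by (simp add: norm_ell1.rep_eq)
    have "(\<Sum>\<gamma>\<in>G. norm (ell1_coord y \<gamma>))
        \<le> (\<Sum>\<gamma>\<in>G. norm (ell1_coord (y + v n) \<gamma>) + norm (ell1_coord (v n) \<gamma>))"
      by (intro sum_mono)
        (metis add_diff_cancel_right' norm_triangle_ineq4 plus_ell1.rep_eq)
    moreover have "(\<Sum>\<^sub>\<infinity>\<gamma>\<in>-G. norm (ell1_coord (v n) \<gamma>))
        \<le> (\<Sum>\<^sub>\<infinity>\<gamma>\<in>-G. norm (ell1_coord (y + v n) \<gamma>) + norm (ell1_coord y \<gamma>))"
      by (intro infsum_mono sm summable_on_add)
        (metis add_diff_cancel_left' norm_triangle_ineq4 plus_ell1.rep_eq)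
    ultimately show "norm (y + v n) \<ge> norm y + norm (v n) - e"
      using Gy n split[of y] split[of "v n"] split[of "y + v n"] infsum_add[OF sm[of "y + v n" "-G"] sm[of y "-G"]]
      by (simp add: sum.distrib dist_real_def abs_le_iff)
  qed
qed

text \<open>
  The gliding hump: each further summand is chosen so late that at most \<open>d / 2\<close> of its norm is lost.
\<close>

lemma ell1_coordwise_null_large_sum:
  fixes v :: "nat \<Rightarrow> ('g, 'k::real_normed_field) ell1"
  assumes v: "\<And>\<gamma>. (\<lambda>n. ell1_coord (v n) \<gamma>) \<longlonglongrightarrow> 0"
    and d: "d > 0" "\<And>n. norm (v n) \<ge> d"
  shows "\<exists>F. finite F \<and> card F = N \<and> norm (\<Sum>n\<in>F. v n) \<ge> d / 2 * N"
proof (induction N)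
  case 0
  then show ?case by (intro exI[of _ "{}"]) auto
next
  case (Suc N)
  then obtain F where F: "finite F" "card F = N" "norm (\<Sum>n\<in>F. v n) \<ge> d / 2 * N" by blast
  from F(1) obtain M where M: "\<And>n. n \<in> F \<Longrightarrow> n < M" unfolding finite_nat_set_iff_bounded by blast
  have "\<forall>\<^sub>F n in sequentially. norm ((\<Sum>n\<in>F. v n) + v n) \<ge> norm (\<Sum>n\<in>F. v n) + norm (v n) - d / 2"
    by (rule ell1_norm_add_almost_additive[OF v]) (use d in simp)
  then obtain n where n: "norm ((\<Sum>n\<in>F. v n) + v n) \<ge> norm (\<Sum>n\<in>F. v n) + norm (v n) - d / 2" "n \<ge> M"
    using eventually_ge_at_top[of M] eventually_happens'[OF sequentially_bot, OF eventually_conj] by blast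
  then have "n \<notin> F" using M by fastforce
  moreover from this have "norm (\<Sum>i\<in>insert n F. v i) \<ge> d / 2 * Suc N"
    using n F d(2)[of n] by (simp add: algebra_simps)
  ultimately show ?case using F by (intro exI[of _ "insert n F"]) simp
qed

lemma linear_continuous_bound:
  fixes f :: "'a::real_normed_vector \<Rightarrow> 'b::real_normed_vector"
  assumes lin: "linear f" and cont: "isCont f 0"
  obtains B where "B > 0" "\<And>x. norm (f x) \<le> B * norm x"
proof -
  have f0: "f 0 = 0" using lin by (rule linear_0)
  obtain d where d: "d > 0" "\<And>x. norm x < d \<Longrightarrow> norm (f x) < 1"
    using cont[unfolded continuous_at_eps_delta, rule_format, of 1] f0 by (auto simp: dist_norm)
  have "norm (f x) \<le> 2 / d * norm x" for x
  proof (cases "x = 0")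
    case False
    define t where "t = d / (2 * norm x)"
    have t: "t > 0" using False d by (simp add: t_def)
    have "norm (t *\<^sub>R x) < d" using False d by (simp add: t_def)
    then have "norm (f (t *\<^sub>R x)) < 1" by (rule d)
    then have "t * norm (f x) < 1" using t by (simp add: linear_scale[OF lin])
    then show ?thesis using False d by (simp add: t_def field_simps)
  qed (simp add: f0)
  then show thesis using d(1) by (intro that[of "2 / d"]) auto
qed

text \<open>
  The images of the unit vectors are coordinatewise null and bounded away from \<open>0\<close>, so some sums of
  \<open>N\<close> of them grow linearly in \<open>N\<close>, whereas the boundedness of \<open>T\<close> permits only growth like \<open>\<surd>N\<close>.
\<close>

lemma X_not_embeddable_in_ell1:
  fixes T :: "'k::{real_normed_field,banach} X_space \<Rightarrow> ('g, 'k) ell1"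
  assumes lin: "Vector_Spaces.linear scale_X scale_ell1 T" and hom: "homeomorphism UNIV Y T S"
  shows False
proof -
  interpret T: Vector_Spaces.linear scale_X scale_ell1 T by (rule lin)
  interpret X: banach_over "scale_X :: 'k \<Rightarrow> _" by (rule banach_over_scale_X)
  interpret L: banach_over "scale_ell1 :: 'k \<Rightarrow> ('g, 'k) ell1 \<Rightarrow> _" by (rule banach_over_scale_ell1)
  have ST: "S (T x) = x" and TY: "T x \<in> Y" for x using hom by (auto simp: homeomorphism_def)
  have "linear T"
    by (intro linearI) (simp_all add: T.add X.scale_of_real[symmetric] L.scale_of_real[symmetric] T.scale)
  moreover have "isCont T 0"
    using hom by (simp add: homeomorphism_def continuous_on_eq_continuous_at)
  ultimately obtain B where B: "B > 0" "\<And>x. norm (T x) \<le> B * norm x"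
    using linear_continuous_bound by blast
  define v :: "nat \<Rightarrow> ('g, 'k) ell1" where "v n = T (unit_X n)" for n
  have v_le: "norm (\<Sum>n\<in>F. scale_ell1 (c n) (v n)) \<le> B * sqrt (card F)"
    if "finite F" "\<And>n. norm (c n) \<le> 1" for F and c :: "nat \<Rightarrow> 'k"
  proof -
    have "(\<Sum>n\<in>F. scale_ell1 (c n) (v n)) = T (\<Sum>n\<in>F. scale_X (c n) (unit_X n))"
      by (simp add: v_def T.sum T.scale)
    also have "norm \<dots> \<le> B * norm (\<Sum>n\<in>F. scale_X (c n) (unit_X n))" by (rule B(2))
    also have "\<dots> \<le> B * sqrt (card F)"
      using norm_sum_unit_X_le[OF that] B(1) by simp
    finally show ?thesis .
  qed
  have coord_sum: "ell1_coord (\<Sum>n\<in>F. f n) \<gamma> = (\<Sum>n\<in>F. ell1_coord (f n) \<gamma>)"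
    for F and f :: "nat \<Rightarrow> ('g, 'k) ell1" and \<gamma>
    by (induction F rule: infinite_finite_induct) (auto simp: zero_ell1.rep_eq plus_ell1.rep_eq)
  have "(\<lambda>n. ell1_coord (v n) \<gamma>) \<longlonglongrightarrow> 0" for \<gamma>
  proof (rule tendsto_zero_if_combinations_le_sqrt)
    fix F :: "nat set" and c :: "nat \<Rightarrow> 'k" assume "finite F" "\<And>n. norm (c n) \<le> 1"
    from order_trans[OF norm_ell1_coord_le v_le[OF this]]
    show "norm (\<Sum>n\<in>F. c n * ell1_coord (v n) \<gamma>) \<le> B * sqrt (card F)"
      by (simp add: coord_sum scale_ell1.rep_eq)
  qed
  moreover obtain d where d: "d > 0" "\<And>n. norm (v n) \<ge> d"
  proof -
    \<comment> \<open>The inverse is continuous at zero, so images too close to zero would force the unit vectors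
      to have norm less than one.\<close>
    have "continuous_on Y S" using hom by (simp add: homeomorphism_def)
    then obtain d where d: "d > 0" "\<And>y. y \<in> Y \<Longrightarrow> dist y (T 0) < d \<Longrightarrow> dist (S y) (S (T 0)) < 1"
      unfolding continuous_on_iff using TY zero_less_one by metis
    have "norm (v n) \<ge> d" for n
    proof (rule ccontr)
      assume "\<not> norm (v n) \<ge> d"
      then have "dist (S (v n)) (S (T 0)) < 1"
        by (intro d(2)) (auto simp: v_def TY T.zero)
      then show False unfolding v_def ST by (simp add: norm_unit_X)
    qed
    with d(1) show thesis by (rule that)
  qed
  ultimately have large: "\<exists>F. finite F \<and> card F = N \<and> norm (\<Sum>n\<in>F. v n) \<ge> d / 2 * N" for N
    by (rule ell1_coordwise_null_large_sum)
  obtain N :: nat where N: "B * sqrt N < d / 2 * N" using sqrt_less_linear[of "d / 2" B] d(1) by auto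
  obtain F where F: "finite F" "card F = N" "norm (\<Sum>n\<in>F. v n) \<ge> d / 2 * N" using large by blast
  have "d / 2 * N \<le> B * sqrt N" using v_le[OF F(1), of "\<lambda>_. 1"] F by simp
  then show False using N by simp
qed

theorem proposition4p1:
  fixes \<Gamma> :: "'g set"
  shows "(\<forall>n. (\<forall>x :: 'k::{real_normed_field,banach} X_space. coord_functional n x = X_coord x n) \<and>
      (coord_functional n :: 'k X_space \<Rightarrow>\<^sub>L 'k) \<in> dual_space scale_X \<and>
      norm (coord_functional n :: 'k X_space \<Rightarrow>\<^sub>L 'k) = 1) \<and>
    limitin (weak_topology_dual (scale_X :: 'k \<Rightarrow> _)) coord_functional 0 sequentially \<and>
    (\<nexists>r. strict_mono r \<and> strongly_normal (scale_X :: 'k \<Rightarrow> _) (coord_functional \<circ> r)) \<and>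
    (\<nexists>(T :: 'k X_space \<Rightarrow> ('g, 'k) ell1) S.
      Vector_Spaces.linear scale_X scale_ell1 T \<and> homeomorphism UNIV (ell1_on \<Gamma>) T S)"
proof (intro conjI allI notI)
  show "limitin (weak_topology_dual (scale_X :: 'k \<Rightarrow> _)) coord_functional 0 sequentially"
    by (rule coord_functional_weakly_null)
next
  assume "\<exists>r. strict_mono r \<and> strongly_normal (scale_X :: 'k \<Rightarrow> _) (coord_functional \<circ> r)"
  then show False
    using coord_functional_not_strongly_normal strict_mono_imp_inj_on by metis
next
  assume "\<exists>(T :: 'k X_space \<Rightarrow> ('g, 'k) ell1) S.
    Vector_Spaces.linear scale_X scale_ell1 T \<and> homeomorphism UNIV (ell1_on \<Gamma>) T S"
  then show False by (elim exE conjE) (rule X_not_embeddable_in_ell1)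
qed (simp_all add: coord_functional_apply coord_functional_in_dual_space norm_coord_functional)

end
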